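(* Let $X$ be a first countable Urysohn space with a regular $G_\delta$-diagonal. Then $|X|\le wL(X)^{\omega}$.
   Context: A topological space $X$ is Urysohn if every two distinct points of $X$ have disjoint closed neighborhoods. Write $\Delta_X=\{(x,x)\in X^2:x\in X\}$. $X$ has a regular $G_\delta$-diagonal if there is a sequence $(U_n:n<\omega)$ of open sets in $X^2$ such that $\Delta_X=\bigcap_{n<\omega}U_n=\bigcap_{n<\omega}\overline{U_n}$. The weak Lindelöf number $wL(X)$ is the smallest infinite cardinal $\kappa$ such that every open cover of $X$ has a subcollection of cardinality $\le\kappa$ whose union is dense in $X$. *)

theory Defs
  imports "HOL-Analysis.Analysis"
begin

(* this input notation clashes with equality of cardinals *)
no_notation elt_set_eq (infix "=o" 50)
unbundle cardinal_syntax

definition Urysohn_space :: "'a topology \<Rightarrow> bool" where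
  "Urysohn_space X \<longleftrightarrow>
     (\<forall>x \<in> topspace X. \<forall>y \<in> topspace X. x \<noteq> y \<longrightarrow>
        (\<exists>C D. closedin X C \<and> closedin X D \<and>
               x \<in> X interior_of C \<and> y \<in> X interior_of D \<and> C \<inter> D = {}))"

definition diagonal :: "'a topology \<Rightarrow> ('a \<times> 'a) set" where
  "diagonal X = {(x, x) | x. x \<in> topspace X}"

definition regular_G_delta_diagonal :: "'a topology \<Rightarrow> bool" where
  "regular_G_delta_diagonal X \<longleftrightarrow>
     (\<exists>U :: nat \<Rightarrow> ('a \<times> 'a) set.
        (\<forall>n. openin (prod_topology X X) (U n)) \<and>
        diagonal X = (\<Inter>n. U n) \<and>
        diagonal X = (\<Inter>n. prod_topology X X closure_of U n))"

definition weak_Lindelof_bound :: "'a topology \<Rightarrow> 'k rel \<Rightarrow> bool" where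
  "weak_Lindelof_bound X \<kappa> \<longleftrightarrow>
     Cinfinite \<kappa> \<and>
     (\<forall>\<U>. (\<forall>U \<in> \<U>. openin X U) \<and> \<Union>\<U> = topspace X \<longrightarrow>
        (\<exists>\<V>. \<V> \<subseteq> \<U> \<and> |\<V>| \<le>o \<kappa> \<and> X closure_of (\<Union>\<V>) = topspace X))"

(* HOL has no type of all cardinals.  The minimum is taken over the cardinals on 'a + nat;
   this type always carries one satisfying the bound, and by wL_least below the resulting
   cardinal is least among the cardinals on every type. *)
definition wL :: "'a topology \<Rightarrow> ('a + nat) rel" where
  "wL X = (SOME \<kappa>. weak_Lindelof_bound X \<kappa> \<and>
                   (\<forall>\<kappa>' :: ('a + nat) rel. weak_Lindelof_bound X \<kappa>' \<longrightarrow> \<kappa> \<le>o \<kappa>'))"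

lemma weak_Lindelof_bound_UNIV: "weak_Lindelof_bound X |UNIV :: ('a + nat) set|"
  for X :: "'a topology"
  unfolding weak_Lindelof_bound_def
proof (intro conjI allI impI)
  show "cinfinite |UNIV :: ('a + nat) set|"
    by (simp add: cinfinite_def Field_card_of)
  show "Card_order |UNIV :: ('a + nat) set|"
    by (rule card_of_Card_order)
next
  fix \<U> :: "'a set set"
  assume \<U>: "(\<forall>U \<in> \<U>. openin X U) \<and> \<Union>\<U> = topspace X"
  then have "\<forall>x \<in> topspace X. \<exists>U \<in> \<U>. x \<in> U"
    by blast
  then obtain f where f: "\<And>x. x \<in> topspace X \<Longrightarrow> f x \<in> \<U> \<and> x \<in> f x"
    by metis
  have sub: "f ` topspace X \<subseteq> \<U>"
    using f by blast
  then have "\<Union>(f ` topspace X) = topspace X"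
    using f \<U> by blast
  then have dense: "X closure_of \<Union>(f ` topspace X) = topspace X"
    by simp
  have "|topspace X| \<le>o |UNIV :: ('a + nat) set|"
    using card_of_ordLeq[of "topspace X" "UNIV :: ('a + nat) set"] inj_on_subset[OF inj_Inl] by blast
  then have "|f ` topspace X| \<le>o |UNIV :: ('a + nat) set|"
    using card_of_image ordLeq_transitive by blast
  with sub dense
  show "\<exists>\<V>. \<V> \<subseteq> \<U> \<and> |\<V>| \<le>o |UNIV :: ('a + nat) set| \<and> X closure_of (\<Union>\<V>) = topspace X"
    by blast
qed

lemma
  fixes X :: "'a topology" and \<kappa> :: "('a + nat) rel"
  shows weak_Lindelof_bound_wL: "weak_Lindelof_bound X (wL X)"
    and wL_least_same_type: "weak_Lindelof_bound X \<kappa> \<Longrightarrow> wL X \<le>o \<kappa>"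
proof -
  let ?R = "{\<kappa> :: ('a + nat) rel. weak_Lindelof_bound X \<kappa>}"
  have "\<exists>r \<in> ?R. \<forall>r' \<in> ?R. r \<le>o r'"
  proof (rule exists_minim_Card_order)
    show "?R \<noteq> {}"
      using weak_Lindelof_bound_UNIV[of X] by blast
    show "\<forall>r \<in> ?R. Card_order r"
      by (simp add: weak_Lindelof_bound_def)
  qed
  then have "\<exists>\<kappa> :: ('a + nat) rel. weak_Lindelof_bound X \<kappa> \<and>
      (\<forall>\<kappa>' :: ('a + nat) rel. weak_Lindelof_bound X \<kappa>' \<longrightarrow> \<kappa> \<le>o \<kappa>')"
    unfolding Bex_def Ball_def mem_Collect_eq .
  from someI_ex[OF this]
  have *: "weak_Lindelof_bound X (wL X) \<and>
      (\<forall>\<kappa>' :: ('a + nat) rel. weak_Lindelof_bound X \<kappa>' \<longrightarrow> wL X \<le>o \<kappa>')"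
    unfolding wL_def .
  show "weak_Lindelof_bound X (wL X)"
    by (rule conjunct1[OF *])
  show "wL X \<le>o \<kappa>" if "weak_Lindelof_bound X \<kappa>"
    by (rule conjunct2[OF *, rule_format, OF that])
qed

lemma weak_Lindelof_bound_ordIso:
  fixes X :: "'a topology"
  assumes "weak_Lindelof_bound X \<kappa>" and iso: "\<kappa> =o \<kappa>'"
  shows "weak_Lindelof_bound X \<kappa>'"
proof -
  show ?thesis
    unfolding weak_Lindelof_bound_def
  proof (intro conjI allI impI)
    have "Cinfinite \<kappa>"
      using assms(1) by (simp add: weak_Lindelof_bound_def)
    then have *: "Cinfinite \<kappa>'"
      by (rule Cinfinite_cong[OF iso])
    show "cinfinite \<kappa>'" by (rule conjunct1[OF *])
    show "Card_order \<kappa>'" by (rule conjunct2[OF *])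
  next
    fix \<U> :: "'a set set"
    assume "(\<forall>U \<in> \<U>. openin X U) \<and> \<Union>\<U> = topspace X"
    then obtain \<V> where \<V>: "\<V> \<subseteq> \<U>" "|\<V>| \<le>o \<kappa>" "X closure_of (\<Union>\<V>) = topspace X"
      using assms(1) unfolding weak_Lindelof_bound_def by metis
    show "\<exists>\<V>. \<V> \<subseteq> \<U> \<and> |\<V>| \<le>o \<kappa>' \<and> X closure_of (\<Union>\<V>) = topspace X"
      by (intro exI[of _ \<V>] conjI \<V>(1,3) ordLeq_ordIso_trans[OF \<V>(2) iso])
  qed
qed

lemma wL_least:
  fixes X :: "'a topology" and \<kappa> :: "'k rel"
  assumes "weak_Lindelof_bound X \<kappa>"
  shows "wL X \<le>o \<kappa>"
proof (rule ccontr)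
  assume *: "\<not> wL X \<le>o \<kappa>"
  have wo: "Well_order (wL X)" "Well_order \<kappa>"
    using assms weak_Lindelof_bound_wL[of X]
    unfolding weak_Lindelof_bound_def card_order_on_def by blast+
  with * have "\<kappa> <o wL X"
    using ordLess_or_ordLeq by blast
  then obtain p :: "('a + nat) rel" where p: "\<kappa> =o p"
    unfolding internalize_ordLess[of \<kappa> "wL X"] by (elim exE conjE)
  have "wL X \<le>o p"
    by (rule wL_least_same_type[OF weak_Lindelof_bound_ordIso[OF assms p]])
  then have "wL X \<le>o \<kappa>"
    by (rule ordLeq_ordIso_trans[OF _ ordIso_symmetric[OF p]])
  with * show False ..
qed

end

theory Submission
  imports Defs
begin

text \<open>Cover the space by the open sets \<open>W\<close> with \<open>W \<times> W \<subseteq> U n\<close> and take small dense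
  subfamilies \<open>\<V> n\<close>. Map a point \<open>x\<close> to the choice, for all \<open>n\<close> and \<open>m\<close>, of a member of
  \<open>\<V> n\<close> that meets the \<open>m\<close>-th basic neighbourhood of \<open>x\<close>. If \<open>x\<close> and \<open>y\<close> yield the same
  choices, then every neighbourhood of \<open>(x, y)\<close> meets every \<open>U n\<close>, so \<open>x = y\<close>.\<close>

text \<open>Monotonicity is what the injectivity argument needs: neighbourhoods of two different
  points, chosen at different indices, can both be shrunk to one common index.\<close>

lemma first_countable_decseq_base:
  assumes "first_countable X"
  obtains B :: "'a \<Rightarrow> nat \<Rightarrow> 'a set" where
    "\<And>x n. x \<in> topspace X \<Longrightarrow> openin X (B x n) \<and> x \<in> B x n"
    "\<And>x. decseq (B x)"
    "\<And>x U. openin X U \<Longrightarrow> x \<in> U \<Longrightarrow> \<exists>n. B x n \<subseteq> U"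
proof -
  have "\<exists>B :: nat \<Rightarrow> 'a set. decseq B \<and> (\<forall>n. openin X (B n) \<and> x \<in> B n) \<and>
      (\<forall>U. openin X U \<and> x \<in> U \<longrightarrow> (\<exists>n. B n \<subseteq> U))" if x: "x \<in> topspace X" for x
  proof -
    obtain \<B> where \<B>: "countable \<B>" "\<And>V. V \<in> \<B> \<Longrightarrow> openin X V"
      "\<And>U. openin X U \<Longrightarrow> x \<in> U \<Longrightarrow> \<exists>V\<in>\<B>. x \<in> V \<and> V \<subseteq> U"
      using assms x unfolding first_countable_def by metis
    define \<C> where "\<C> = {V \<in> \<B>. x \<in> V}"
    \<comment> \<open>Nonemptiness comes from applying the base property to the whole space; it
      ensures that \<open>from_nat_into \<C>\<close> enumerates exactly \<open>\<C>\<close>.\<close>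
    have "countable \<C>" "\<C> \<noteq> {}"
      using \<B>(1) \<B>(3)[of "topspace X"] x by (auto simp: \<C>_def)
    then have rng: "range (from_nat_into \<C>) = \<C>"
      by (rule range_from_nat_into[rotated])
    \<comment> \<open>Intersecting initial segments of the enumeration makes the sequence
      decreasing; each intersection is finite, hence still open.\<close>
    define B where "B n = (\<Inter>i\<le>n. from_nat_into \<C> i)" for n
    have C: "openin X (from_nat_into \<C> i) \<and> x \<in> from_nat_into \<C> i" for i
      using rng \<B>(2) unfolding \<C>_def by blast
    have "decseq B"
      unfolding decseq_def B_def by (auto intro: order_trans)
    moreover have "openin X (B n) \<and> x \<in> B n" for n
      unfolding B_def using C by (auto intro!: openin_INT)
    moreover have "\<exists>n. B n \<subseteq> U" if U: "openin X U" "x \<in> U" for U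
    proof -
      obtain V where V: "V \<in> \<C>" "V \<subseteq> U"
        using \<B>(3)[OF U] by (auto simp: \<C>_def)
      then obtain i where "V = from_nat_into \<C> i"
        using rng by blast
      with V show ?thesis unfolding B_def by blast
    qed
    ultimately show ?thesis by blast
  qed
  then obtain B where B: "\<And>x. x \<in> topspace X \<Longrightarrow> decseq (B x) \<and>
      (\<forall>n :: nat. openin X (B x n) \<and> x \<in> B x n) \<and> (\<forall>U. openin X U \<and> x \<in> U \<longrightarrow> (\<exists>n. B x n \<subseteq> U))"
    by metis
  \<comment> \<open>The default value \<open>{}\<close> outside the space makes
    \<open>decseq\<close> hold for every \<open>x\<close>. In the last property
    \<open>x \<in> U\<close> with \<open>U\<close> open already puts \<open>x\<close> in the
    space.\<close>
  show thesis
  proof (rule that[of "\<lambda>x. if x \<in> topspace X then B x else (\<lambda>_. {})"])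
    show "\<exists>n. (if x \<in> topspace X then B x else (\<lambda>_. {})) n \<subseteq> U"
      if "openin X U" "x \<in> U" for x U
      using B[of x] that openin_subset[OF that(1)] by auto
  qed (use B in \<open>auto simp: decseq_def\<close>)
qed

text \<open>A diagonal point \<open>(x, x)\<close> has an open box \<open>P \<times> Q\<close>
  inside \<open>U\<close>, and the square of \<open>P \<inter> Q\<close> lies in that box. Hence the
  open sets with square inside \<open>U\<close> cover the space, and the weak Lindelof bound applies
  to them.\<close>

lemma weak_Lindelof_bound_small_squares:
  assumes "weak_Lindelof_bound X \<kappa>"
    and "openin (prod_topology X X) U" and "diagonal X \<subseteq> U"
  obtains \<V> where "|\<V>| \<le>o \<kappa>" "X closure_of \<Union>\<V> = topspace X" "\<And>V. V \<in> \<V> \<Longrightarrow> V \<times> V \<subseteq> U"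
proof -
  define \<W> where "\<W> = {W. openin X W \<and> W \<times> W \<subseteq> U}"
  have "\<exists>W\<in>\<W>. x \<in> W" if x: "x \<in> topspace X" for x
  proof -
    have "(x, x) \<in> U"
      using assms(3) x by (auto simp: diagonal_def)
    then obtain P Q where "openin X P" "openin X Q" "x \<in> P" "x \<in> Q" "P \<times> Q \<subseteq> U"
      using assms(2) unfolding openin_prod_topology_alt by metis
    then have "P \<inter> Q \<in> \<W>" "x \<in> P \<inter> Q"
      by (auto simp: \<W>_def)
    then show ?thesis by blast
  qed
  then have "(\<forall>W \<in> \<W>. openin X W) \<and> \<Union>\<W> = topspace X"
    using openin_subset by (fastforce simp: \<W>_def)
  then obtain \<V> where "\<V> \<subseteq> \<W>" "|\<V>| \<le>o \<kappa>" "X closure_of \<Union>\<V> = topspace X"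
    using assms(1) unfolding weak_Lindelof_bound_def by metis
  then show thesis
    by (intro that[of \<V>]) (auto simp: \<W>_def)
qed

lemma card_of_regular_G_delta_diagonal_le:
  fixes X :: "'a topology"
  assumes "first_countable X" and "regular_G_delta_diagonal X" and \<kappa>: "weak_Lindelof_bound X \<kappa>"
  shows "|topspace X| \<le>o \<kappa> ^c natLeq"
proof -
  obtain U :: "nat \<Rightarrow> ('a \<times> 'a) set" where U: "\<And>n. openin (prod_topology X X) (U n)"
      "diagonal X = (\<Inter>n. U n)" "diagonal X = (\<Inter>n. prod_topology X X closure_of U n)"
    using assms(2) unfolding regular_G_delta_diagonal_def by metis
  obtain B where B: "\<And>x n. x \<in> topspace X \<Longrightarrow> openin X (B x n) \<and> x \<in> B x n"
      "\<And>x. decseq (B x)" "\<And>x U. openin X U \<Longrightarrow> x \<in> U \<Longrightarrow> \<exists>n :: nat. B x n \<subseteq> U"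
    using first_countable_decseq_base[OF assms(1)] by blast
  have "\<exists>\<V>. |\<V>| \<le>o \<kappa> \<and> X closure_of \<Union>\<V> = topspace X \<and> (\<forall>V\<in>\<V>. V \<times> V \<subseteq> U n)" for n
    using weak_Lindelof_bound_small_squares[OF \<kappa> U(1)[of n]] U(2) by (metis INT_lower UNIV_I)
  then obtain \<V> where \<V>: "\<And>n. |\<V> n| \<le>o \<kappa>" "\<And>n. X closure_of \<Union>(\<V> n) = topspace X"
      "\<And>n V. V \<in> \<V> n \<Longrightarrow> V \<times> V \<subseteq> U n"
    by metis
  define \<A> where "\<A> = (\<Union>n. \<V> n)"
  have "\<exists>V\<in>\<V> n. V \<inter> B x m \<noteq> {}" if "x \<in> topspace X" for x n m
    using that B(1)[OF that, of m] \<V>(2)[of n] in_closure_of[of x X "\<Union>(\<V> n)"] by blast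
  then obtain F where F: "\<And>x n m. x \<in> topspace X \<Longrightarrow> F x n m \<in> \<V> n \<and> F x n m \<inter> B x m \<noteq> {}"
    by metis
  define G where "G x = (\<lambda>(n, m). F x n m)" for x
  have "inj_on G (topspace X)"
  proof (rule inj_onI)
    fix x y assume x: "x \<in> topspace X" and y: "y \<in> topspace X" and "G x = G y"
    then have FF: "F x n m = F y n m" for n m
      by (auto simp: G_def fun_eq_iff)
    \<comment> \<open>Membership in all these closures suffices, because their intersection is the
      diagonal.\<close>
    have "(x, y) \<in> prod_topology X X closure_of U n" for n
      unfolding in_closure_of
    proof (intro conjI allI impI)
      fix T assume "(x, y) \<in> T \<and> openin (prod_topology X X) T"
      then obtain P Q where PQ: "openin X P" "openin X Q" "x \<in> P" "y \<in> Q" "P \<times> Q \<subseteq> T"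
        unfolding openin_prod_topology_alt by metis
      obtain i j where "B x i \<subseteq> P" "B y j \<subseteq> Q"
        using B(3) PQ by meson
      then have sub: "B x (max i j) \<subseteq> P" "B y (max i j) \<subseteq> Q"
        using decseqD[OF B(2), of i "max i j" x] decseqD[OF B(2), of j "max i j" y] by auto
      \<comment> \<open>By \<open>FF\<close> a single member of \<open>\<V> n\<close> meets the
        neighbourhoods of both points. Its square lies in \<open>U n\<close>, so
        \<open>(p, q)\<close> does too.\<close>
      obtain p q where "p \<in> F x n (max i j) \<inter> B x (max i j)" "q \<in> F x n (max i j) \<inter> B y (max i j)"
        using F[OF x] F[OF y] FF by (metis ex_in_conv)
      moreover have "F x n (max i j) \<times> F x n (max i j) \<subseteq> U n"
        using \<V>(3) F[OF x] by blast
      ultimately have "(p, q) \<in> U n \<inter> T"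
        using sub PQ(5) by blast
      then show "\<exists>z. z \<in> U n \<and> z \<in> T" by blast
    qed (use x y in auto)
    then have "(x, y) \<in> diagonal X"
      using U(3) by blast
    then show "x = y"
      by (auto simp: diagonal_def)
  qed
  moreover have "G ` topspace X \<subseteq> Func UNIV \<A>"
    using F by (auto simp: Func_def \<A>_def G_def)
  ultimately have "|topspace X| \<le>o |Func (UNIV :: (nat \<times> nat) set) \<A>|"
    by (metis card_of_ordLeq)
  also have "|Func (UNIV :: (nat \<times> nat) set) \<A>| =o |\<A>| ^c |UNIV :: (nat \<times> nat) set|"
    by (simp add: cexp_def Field_card_of card_of_refl)
  also have "|\<A>| ^c |UNIV :: (nat \<times> nat) set| =o |\<A>| ^c natLeq"
  proof (rule cexp_cong2)
    have "|UNIV :: (nat \<times> nat) set| =o |UNIV :: nat set|"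
      using card_of_ordIso bij_prod_encode by blast
    then show "|UNIV :: (nat \<times> nat) set| =o natLeq"
      using card_of_nat ordIso_transitive by blast
  qed (rule card_of_Card_order natLeq_Card_order)+
  also have "|\<A>| ^c natLeq \<le>o \<kappa> ^c natLeq"
  proof (rule cexp_mono1)
    have "Cinfinite \<kappa>"
      using \<kappa> by (simp add: weak_Lindelof_bound_def)
    \<comment> \<open>The infinite cardinal \<kappa> absorbs the countable union of families of size
      at most \<kappa>.\<close>
    moreover from this have "|UNIV :: nat set| \<le>o \<kappa>"
      using natLeq_ordLeq_cinfinite card_of_nat ordIso_ordLeq_trans by blast
    ultimately show "|\<A>| \<le>o \<kappa>"
      unfolding \<A>_def using \<V>(1) by (intro UNION_Cinfinite_bound) auto
  qed (rule natLeq_Card_order)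
  finally show ?thesis .
qed

theorem corollary4p8:
  fixes X :: "'a topology"
  assumes "first_countable X"
    and "Urysohn_space X"
    and "regular_G_delta_diagonal X"
  shows "|topspace X| \<le>o wL X ^c natLeq"
  using assms(1,3) weak_Lindelof_bound_wL by (rule card_of_regular_G_delta_diagonal_le)

end
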